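(* Let $(\Omega,\mathcal{F},P)$ be a complete and nonatomic probability space, let $\Xi$ be a separable metric space equipped with its Borel $\sigma$-algebra $\mathcal{B}(\Xi)$, let $\xi\colon\Omega\to\Xi$ be a random element, let $p\in[1,+\infty)$, $\varepsilon\ge 0$, and $r\in\mathbb{N}$. Let $\psi\colon\mathbb{R}^r\to(-\infty,+\infty]$ be a proper, closed, and convex function with compact domain $X:=\{x\in\mathbb{R}^r:\psi(x)<+\infty\}$. Suppose that for each $j\in\{1,\dots,r\}$ the pair $(\rho_j,F^j)$, where $\rho_j\colon\mathcal{L}^p(\Omega,\mathcal{F},P)\to\mathbb{R}$ and $F^j\colon\mathbb{R}^r\times\Xi\to\mathbb{R}$, satisfies: (1) $F^j$ restricted to $X\times\Xi$ is a Carathéodory function; (2) the map $x\mapsto F^j_x(\xi):=F^j(x,\xi)$ from $X$ to $\mathcal{L}^p(\Omega,\mathcal{F},P)$ is continuous; (3) there is a random variable $\kappa_j\colon\Xi\to\mathbb{R}$ with $\kappa_j\circ\xi\in\mathcal{L}^{p+\varepsilon}(\Omega,\mathcal{F},P)$ and $|F^j(x,\xi)|\le\kappa_j(\xi)$ for each $x\in X$ and each (deterministic) $\xi\in\Xi$; (4) $\rho_j$ is a convex, law invariant, and Lipschitz continuous risk measure. Suppose further that $(\xi^i)_{i\in\mathbb{N}}$ is a sequence of $\Xi$-valued random elements defined on a probability space $(\Theta,\mathcal{A},\mathbb{P})$ such that for each random variable $\vartheta\colon\Xi\to\mathbb{R}$ with $\vartheta\circ\xi\in\mathcal{L}^{1+\varepsilon/p}(\Omega,\mathcal{F},P)$,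 $$\frac1N\sum_{i=1}^N\vartheta(\xi^i(\theta))\to\int_\Omega\vartheta\circ\xi\,\mathrm{d}P\quad\text{as }N\to\infty\quad\text{for }\mathbb{P}\text{-almost all }\theta\in\Theta,$$ and for $N\in\mathbb{N}$, $\theta\in\Theta$ let $\nu_{N,\theta}:=\frac1N\sum_{i=1}^N\delta_{\xi^i(\theta)}$ be the empirical probability measure on $(\Xi,\mathcal{B}(\Xi))$. If for $\mathbb{P}$-almost all $\theta\in\Theta$ there exists a sequence $(x_{N,\theta})_{N\in\mathbb{N}}\subset X$ such that, for all $N\in\mathbb{N}$, $x=x_{N,\theta}$ solves $$0\in\bigl[\rho_1(\nu_{N,\theta}\circ(F^1_x)^{-1}),\dots,\rho_r(\nu_{N,\theta}\circ(F^r_x)^{-1})\bigr]+\partial\psi(x),$$ then for $\mathbb{P}$-almost all $\theta\in\Theta$, each accumulation point of $(x_{N,\theta})_{N\in\mathbb{N}}$ solves $$0\in\bigl[\rho_1(F^1_x(\xi)),\dots,\rho_r(F^r_x(\xi))\bigr]+\partial\psi(x).$$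
   Context: **Nonatomic.** $(\Omega,\mathcal{F},P)$ is called nonatomic if there exists a random variable $U\colon\Omega\to(0,1)$ with $U\sim\mathrm{Uniform}(0,1)$. **Random variables on $\Xi$.** A random variable $Z\colon\Xi\to\mathbb{R}$ is a Borel measurable map. $F^j_x$ denotes the map $\xi\mapsto F^j(x,\xi)$ on $\Xi$. For a probability measure $\nu$ on $\Xi$, $\nu\circ Z^{-1}$ is the pushforward of $\nu$ under $Z$, a probability measure on $\mathbb{R}$. $\delta_z$ is the Dirac measure at $z$. The symbol $\xi$ denotes both the random element and deterministic elements of $\Xi$. **Carathéodory function.** $G\colon X\times\Xi\to\mathbb{R}$ is Carathéodory if $G(x,\cdot)$ is Borel measurable for each $x\in X$ and $G(\cdot,\upsilon)$ is continuous for each $\upsilon\in\Xi$. **Risk measures.** A functional $\rho\colon\mathcal{L}^p(\Omega,\mathcal{F},P)\to\mathbb{R}$ is law invariant if $\rho(Y)=\rho(Z)$ whenever $Y,Z\in\mathcal{L}^p(\Omega,\mathcal{F},P)$ have the same distribution. A risk measure $\rho$ is convex if it is a convex function, monotone ($V\ge W$ almost surely implies $\rho(V)\ge\rho(W)$), and translation equivariant ($\rho(V+a)=\rho(V)+a$ for all $a\in\mathbb{R}$). Lipschitz continuity is with respect to the $\mathcal{L}^p$ norm. **Risk measures of distributions.** Since $(\Omega,\mathcal{F},P)$ is nonatomic, every probability distribution $Q$ on $\mathbb{R}$ is the distribution of some random variable on $\Omega$. For $Q$ with finite $p$th moment, $\rho(Q)$ denotes the common value $\rho(Y)$ over all $Y\in\mathcal{L}^p(\Omega,\mathcal{F},P)$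 with distribution $Q$. **Subdifferential.** $\partial\psi(x)$ is the subdifferential of the convex function $\psi$ at $x\in\mathbb{R}^r$, and $[a_1,\dots,a_r]$ denotes the vector in $\mathbb{R}^r$ with these entries. *)

theory Defs
  imports "HOL-Probability.Probability" "HOL-Library.Set_Algebras"
begin

definition nonatomic :: "'a measure \<Rightarrow> bool" where
  "nonatomic M \<longleftrightarrow>
    (\<exists>U. U \<in> borel_measurable M \<and> U ` space M \<subseteq> {0<..<1} \<and>
         distr M borel U = uniform_measure lborel {0<..<1::real})"

text \<open>
  The space of \<open>p\<close>-integrable random variables consists of functions, not of equivalence
  classes modulo almost sure equality.
\<close>

definition Lp_space :: "'a measure \<Rightarrow> real \<Rightarrow> ('a \<Rightarrow> real) set" where
  "Lp_space M p = {f \<in> borel_measurable M. integrable M (\<lambda>\<omega>. \<bar>f \<omega>\<bar> powr p)}"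

definition Lp_norm :: "'a measure \<Rightarrow> real \<Rightarrow> ('a \<Rightarrow> real) \<Rightarrow> real" where
  "Lp_norm M p f = (\<integral>\<omega>. \<bar>f \<omega>\<bar> powr p \<partial>M) powr (1 / p)"

definition continuous_into_Lp ::
  "'a measure \<Rightarrow> real \<Rightarrow> 'b::topological_space set \<Rightarrow> ('b \<Rightarrow> 'a \<Rightarrow> real) \<Rightarrow> bool" where
  "continuous_into_Lp M p X G \<longleftrightarrow>
    (\<forall>x\<in>X. G x \<in> Lp_space M p) \<and>
    (\<forall>x\<in>X. ((\<lambda>y. Lp_norm M p (\<lambda>\<omega>. G y \<omega> - G x \<omega>)) \<longlongrightarrow> 0) (at x within X))"

definition caratheodory_on ::
  "'b::topological_space set \<Rightarrow> ('b \<Rightarrow> 'x::topological_space \<Rightarrow> real) \<Rightarrow> bool" where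
  "caratheodory_on X G \<longleftrightarrow>
    (\<forall>x\<in>X. G x \<in> borel_measurable borel) \<and> (\<forall>\<upsilon>. continuous_on X (\<lambda>x. G x \<upsilon>))"

definition law_invariant :: "'a measure \<Rightarrow> real \<Rightarrow> (('a \<Rightarrow> real) \<Rightarrow> real) \<Rightarrow> bool" where
  "law_invariant M p \<rho> \<longleftrightarrow>
    (\<forall>Y\<in>Lp_space M p. \<forall>Z\<in>Lp_space M p. distr M borel Y = distr M borel Z \<longrightarrow> \<rho> Y = \<rho> Z)"

definition convex_risk_measure :: "'a measure \<Rightarrow> real \<Rightarrow> (('a \<Rightarrow> real) \<Rightarrow> real) \<Rightarrow> bool" where
  "convex_risk_measure M p \<rho> \<longleftrightarrow>
    (\<forall>Y\<in>Lp_space M p. \<forall>Z\<in>Lp_space M p. \<forall>t\<in>{0..1}.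
        \<rho> (\<lambda>\<omega>. (1 - t) * Y \<omega> + t * Z \<omega>) \<le> (1 - t) * \<rho> Y + t * \<rho> Z) \<and>
    (\<forall>V\<in>Lp_space M p. \<forall>W\<in>Lp_space M p. (AE \<omega> in M. W \<omega> \<le> V \<omega>) \<longrightarrow> \<rho> W \<le> \<rho> V) \<and>
    (\<forall>V\<in>Lp_space M p. \<forall>a. \<rho> (\<lambda>\<omega>. V \<omega> + a) = \<rho> V + a)"

definition Lipschitz_on_Lp :: "'a measure \<Rightarrow> real \<Rightarrow> (('a \<Rightarrow> real) \<Rightarrow> real) \<Rightarrow> bool" where
  "Lipschitz_on_Lp M p \<rho> \<longleftrightarrow>
    (\<exists>L\<ge>0. \<forall>Y\<in>Lp_space M p. \<forall>Z\<in>Lp_space M p.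
        \<bar>\<rho> Y - \<rho> Z\<bar> \<le> L * Lp_norm M p (\<lambda>\<omega>. Y \<omega> - Z \<omega>))"

text \<open>
  The common value of \<open>\<rho>\<close> on all \<open>p\<close>-integrable random variables with distribution \<open>Q\<close>.
\<close>

definition risk_of_distribution ::
  "'a measure \<Rightarrow> real \<Rightarrow> (('a \<Rightarrow> real) \<Rightarrow> real) \<Rightarrow> real measure \<Rightarrow> real" where
  "risk_of_distribution M p \<rho> Q = the_elem (\<rho> ` {Y \<in> Lp_space M p. distr M borel Y = Q})"

lemma risk_of_distribution_distr:
  assumes "law_invariant M p \<rho>" "Y \<in> Lp_space M p"
  shows "risk_of_distribution M p \<rho> (distr M borel Y) = \<rho> Y"
proof -
  have "\<rho> ` {Z \<in> Lp_space M p. distr M borel Z = distr M borel Y} = {\<rho> Y}"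
    using assms unfolding law_invariant_def by blast
  then show ?thesis
    by (simp add: risk_of_distribution_def)
qed

text \<open>
  The mean of the Dirac measures at \<open>z 1\<close>, ..., \<open>z N\<close>; meaningful for \<open>N \<ge> 1\<close>.
\<close>

definition empirical_measure :: "(nat \<Rightarrow> 'x::topological_space) \<Rightarrow> nat \<Rightarrow> 'x measure" where
  "empirical_measure z N =
    measure_of UNIV (sets borel)
      (\<lambda>A. ennreal (1 / real N) * (\<Sum>i=1..N. emeasure (return borel (z i)) A))"

lemma sets_empirical_measure [simp, measurable_cong]: "sets (empirical_measure z N) = sets borel"
  unfolding empirical_measure_def by (metis sets.sets_measure_of_eq space_borel)

lemma space_empirical_measure [simp]: "space (empirical_measure z N) = UNIV"
  by (simp add: empirical_measure_def space_measure_of_conv)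

lemma emeasure_empirical_measure:
  assumes "A \<in> sets borel"
  shows "emeasure (empirical_measure z N) A =
    ennreal (1 / real N) * (\<Sum>i=1..N. emeasure (return borel (z i)) A)"
proof (rule emeasure_measure_of[OF empirical_measure_def])
  show "sets borel \<subseteq> Pow (UNIV :: 'a set)" by simp
  show "A \<in> sets (empirical_measure z N)" using assms by simp
  show "positive (sets (empirical_measure z N))
     (\<lambda>A. ennreal (1 / real N) * (\<Sum>i=1..N. emeasure (return borel (z i)) A))"
    by (simp add: positive_def)
  show "countably_additive (sets (empirical_measure z N))
     (\<lambda>A. ennreal (1 / real N) * (\<Sum>i=1..N. emeasure (return borel (z i)) A))"
  proof (rule countably_additiveI)
    fix B :: "nat \<Rightarrow> 'a set"
    assume B: "range B \<subseteq> sets (empirical_measure z N)" "disjoint_family B"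
    have "(\<Sum>k. \<Sum>i=1..N. emeasure (return borel (z i)) (B k))
        = (\<Sum>i=1..N. \<Sum>k. emeasure (return borel (z i)) (B k))"
      by (rule suminf_sum) auto
    also have "\<dots> = (\<Sum>i=1..N. emeasure (return borel (z i)) (\<Union>k. B k))"
      using B by (intro sum.cong refl suminf_emeasure) auto
    finally show "(\<Sum>k. ennreal (1 / real N) * (\<Sum>i=1..N. emeasure (return borel (z i)) (B k)))
        = ennreal (1 / real N) * (\<Sum>i=1..N. emeasure (return borel (z i)) (\<Union>k. B k))"
      by simp
  qed
qed

lemma prob_space_empirical_measure:
  assumes "N \<ge> 1"
  shows "prob_space (empirical_measure z N)"
proof
  have "emeasure (empirical_measure z N) UNIV = ennreal (1 / real N) * ennreal (real N)"
    by (simp add: emeasure_empirical_measure ennreal_of_nat_eq_real_of_nat)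
  also have "\<dots> = ennreal (1 / real N * real N)"
    by (rule ennreal_mult'[symmetric]) simp
  also have "\<dots> = 1"
    using assms by simp
  finally show "emeasure (empirical_measure z N) (space (empirical_measure z N)) = 1"
    by simp
qed

definition effective_domain :: "('v \<Rightarrow> ereal) \<Rightarrow> 'v set" where
  "effective_domain \<psi> = {x. \<psi> x < \<infinity>}"

definition ereal_epigraph :: "('v \<Rightarrow> ereal) \<Rightarrow> ('v \<times> real) set" where
  "ereal_epigraph \<psi> = {(x, t). \<psi> x \<le> ereal t}"

definition proper_fun :: "('v \<Rightarrow> ereal) \<Rightarrow> bool" where
  "proper_fun \<psi> \<longleftrightarrow> (\<forall>x. \<psi> x \<noteq> -\<infinity>) \<and> (\<exists>x. \<psi> x < \<infinity>)"

definition closed_fun :: "('v::topological_space \<Rightarrow> ereal) \<Rightarrow> bool" where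
  "closed_fun \<psi> \<longleftrightarrow> closed (ereal_epigraph \<psi>)"

definition convex_fun :: "('v::real_vector \<Rightarrow> ereal) \<Rightarrow> bool" where
  "convex_fun \<psi> \<longleftrightarrow> convex (ereal_epigraph \<psi>)"

text \<open>For proper \<open>\<psi>\<close> the subdifferential is empty outside the effective domain.\<close>

definition subdifferential :: "('v::real_inner \<Rightarrow> ereal) \<Rightarrow> 'v \<Rightarrow> 'v set" where
  "subdifferential \<psi> x = {g. \<forall>y. \<psi> x + ereal (g \<bullet> (y - x)) \<le> \<psi> y}"

definition accumulation_point :: "(nat \<Rightarrow> 'v::topological_space) \<Rightarrow> 'v \<Rightarrow> bool" where
  "accumulation_point u a \<longleftrightarrow> (\<exists>s. strict_mono s \<and> (u \<circ> s) \<longlonglongrightarrow> a)"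

end

theory Submission
  imports Defs
begin

text \<open>
  The heart of the matter is that, almost surely, the empirical risk of \<open>F j\<close> at \<open>u k\<close> converges to
  \<open>\<rho> j (F j a \<circ> \<xi>)\<close> whenever \<open>u k\<close> converges to \<open>a\<close> in \<open>X\<close>; the inclusion then passes to the limit
  because the epigraph of \<open>\<psi>\<close> is closed. Drawing a uniform index on the nonatomic space couples two
  empirical laws, so Lipschitz continuity bounds the difference of the empirical risks of \<open>f\<close> and \<open>g\<close>
  by the \<open>p\<close>-th root of the empirical mean of \<open>\<bar>f - g\<bar> powr p\<close>. Being dominated by a multiple of
  \<open>\<kappa> powr p\<close>, this function obeys the assumed law of large numbers. Hence \<open>F\<close> may be replaced by its
  values on a countable dense set and those by simple functions, for which the empirical laws are
  finitely supported and the quantile coupling applies; only countably many null sets arise.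
\<close>

section \<open>Empirical laws through a uniformly drawn index\<close>

text \<open>Replaces the normalised sum of Dirac measures by an image of a pmf, so that couplings
  can be built from a random index.\<close>

lemma empirical_measure_eq_distr:
  assumes "N \<ge> 1"
  shows "empirical_measure z N = distr (measure_pmf (pmf_of_set {1..N})) borel z"
proof (rule measure_eqI)
  fix A
  assume "A \<in> sets (empirical_measure z N)"
  then have A: "A \<in> sets borel" by simp
  have "emeasure (empirical_measure z N) A = ennreal (1 / real N) * (\<Sum>i=1..N. indicator A (z i))"
    using A by (simp add: emeasure_empirical_measure)
  also have "(\<Sum>i=1..N. indicator A (z i)) = (\<Sum>i=1..N. ennreal (indicator (z -` A) i))"
    by (intro sum.cong) (auto simp: indicator_def)
  also have "\<dots> = ennreal (\<Sum>i=1..N. indicator (z -` A) i)"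
    by (rule sum_ennreal) auto
  also have "(\<Sum>i=1..N. indicator (z -` A) i) = real (card ({1..N} \<inter> z -` A))"
    by (simp add: indicator_def[abs_def] sum.If_cases vimage_def)
  also have "ennreal (1 / real N) * ennreal (real (card ({1..N} \<inter> z -` A)))
      = ennreal (card ({1..N} \<inter> z -` A) / real N)"
    by (subst ennreal_mult[symmetric]) auto
  also have "\<dots> = emeasure (measure_pmf (pmf_of_set {1..N})) (z -` A)"
    using assms by (simp add: emeasure_pmf_of_set)
  also have "\<dots> = emeasure (distr (measure_pmf (pmf_of_set {1..N})) borel z) A"
    using A by (simp add: emeasure_distr)
  finally show "emeasure (empirical_measure z N) A = \<dots>" .
qed simp

text \<open>Puts probabilities under an empirical law into the form of means of indicators, so that
  a law of large numbers can control distribution functions.\<close>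

lemma measure_distr_empirical_measure:
  assumes "N \<ge> 1" "f \<in> borel_measurable borel" "A \<in> sets borel"
  shows "measure (distr (empirical_measure z N) borel f) A
    = (1 / real N) * (\<Sum>i=1..N. indicator (f -` A) (z i))"
proof -
  have "f -` A \<in> sets borel"
    using measurable_sets[OF assms(2,3)] by simp
  then have "measure (distr (empirical_measure z N) borel f) A
      = measure (measure_pmf (pmf_of_set {1..N})) (z -` f -` A)"
    using assms by (simp add: measure_distr empirical_measure_eq_distr)
  also have "\<dots> = real (card ({1..N} \<inter> z -` f -` A)) / real N"
    using assms by (subst measure_pmf_of_set) auto
  also have "real (card ({1..N} \<inter> z -` f -` A)) = (\<Sum>i=1..N. indicator (z -` f -` A) i)"
    by (simp add: indicator_def[abs_def] sum.If_cases vimage_def)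
  also have "\<dots> = (\<Sum>i=1..N. indicator (f -` A) (z i))"
    by (intro sum.cong) (auto simp: indicator_def)
  finally show ?thesis by simp
qed

section \<open>Quantile transforms and realisation of laws on a nonatomic space\<close>

text \<open>The generalised inverse of the distribution function, in the form used by the locale
  \<open>cdf_distribution\<close>, whose facts on \<open>0 < u < 1\<close> therefore apply
  directly.\<close>

definition quantile :: "real measure \<Rightarrow> real \<Rightarrow> real" where
  "quantile Q u = Inf {x. u \<le> cdf Q x}"

lemma quantile_le_iff:
  assumes "real_distribution Q" "0 < u" "u < 1"
  shows "quantile Q u \<le> x \<longleftrightarrow> u \<le> cdf Q x"
proof -
  interpret cdf_distribution Q
    using assms(1) by (rule cdf_distribution.intro)
  show ?thesis
    unfolding quantile_def using pseudoinverse[OF assms(2,3), of x] by (rule sym)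
qed

text \<open>The library's quantile facts live on Lebesgue measure restricted to the open unit
  interval; here the uniform variable is given that target space.\<close>

lemma nonatomicE:
  assumes "nonatomic M"
  obtains U where "U \<in> measurable M (restrict_space lborel {0<..<1::real})"
    "distr M (restrict_space lborel {0<..<1}) U = restrict_space lborel {0<..<1}"
    "\<And>\<omega>. \<omega> \<in> space M \<Longrightarrow> 0 < U \<omega> \<and> U \<omega> < 1"
proof -
  from assms obtain U where U: "U \<in> borel_measurable M" "U ` space M \<subseteq> {0<..<1}"
    and D: "distr M borel U = uniform_measure lborel {0<..<1::real}"
    unfolding nonatomic_def by blast
  have m: "U \<in> measurable M (restrict_space lborel {0<..<1::real})"
    using U by (intro measurable_restrict_space2) auto
  moreover have "distr M (restrict_space lborel {0<..<1}) U = restrict_space lborel {0<..<1}"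
  proof (rule measure_eqI)
    fix A assume "A \<in> sets (distr M (restrict_space lborel {0<..<1}) U)"
    then have A: "A \<in> sets (restrict_space lborel {0<..<1::real})" by simp
    then have A': "A \<in> sets borel" "A \<subseteq> {0<..<1}"
      by (auto simp: sets_restrict_space)
    have "emeasure (distr M (restrict_space lborel {0<..<1}) U) A = emeasure M (U -` A \<inter> space M)"
      using m A by (simp add: emeasure_distr)
    also have "\<dots> = emeasure (distr M borel U) A"
      using U A' by (simp add: emeasure_distr)
    \<comment> \<open>The interval has length one, so the normalising factor of
      \<open>uniform_measure\<close> disappears.\<close>
    also have "\<dots> = emeasure (restrict_space lborel {0<..<1}) A"
      using A' unfolding D
      by (subst emeasure_uniform_measure)
         (auto simp: emeasure_restrict_space Int_absorb1 divide_ennreal_def)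
    finally show "emeasure (distr M (restrict_space lborel {0<..<1}) U) A = \<dots>" .
  qed simp
  ultimately show thesis
    using that[of U] U(2) by (auto simp: image_subset_iff)
qed

text \<open>Inverse transform sampling: the identity known on the unit interval is carried to
  \<open>M\<close> along \<open>U\<close>.\<close>

lemma distr_quantile:
  assumes U: "U \<in> measurable M (restrict_space lborel {0<..<1::real})"
    and D: "distr M (restrict_space lborel {0<..<1}) U = restrict_space lborel {0<..<1}"
    and Q: "real_distribution Q"
  shows "(\<lambda>\<omega>. quantile Q (U \<omega>)) \<in> borel_measurable M"
    and "distr M borel (\<lambda>\<omega>. quantile Q (U \<omega>)) = Q"
proof -
  interpret cdf_distribution Q
    using Q by (rule cdf_distribution.intro)
  have q: "quantile Q \<in> borel_measurable (restrict_space lborel {0<..<1})"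
    using measurable_CI unfolding quantile_def[abs_def]
    by (simp cong: measurable_cong_sets add: sets_restrict_space)
  from measurable_compose[OF U q]
  show "(\<lambda>\<omega>. quantile Q (U \<omega>)) \<in> borel_measurable M" .
  have "distr M borel (\<lambda>\<omega>. quantile Q (U \<omega>))
      = distr (distr M (restrict_space lborel {0<..<1}) U) borel (quantile Q)"
    using distr_distr[OF q U] by (simp add: comp_def)
  also have "\<dots> = Q"
    unfolding D using distr_I_eq_M by (simp add: quantile_def[abs_def])
  finally show "distr M borel (\<lambda>\<omega>. quantile Q (U \<omega>)) = Q" .
qed

text \<open>The law is embedded into the reals, realised there by a quantile transform, and brought
  back by rounding down, which undoes the embedding.\<close>

lemma nonatomic_distr_nat:
  fixes q :: "nat pmf"
  assumes "nonatomic M"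
  obtains J where "J \<in> measurable M (count_space UNIV)"
    "distr M (count_space UNIV) J = measure_pmf q"
proof -
  define Q where "Q = distr (measure_pmf q) borel real"
  have Q: "real_distribution Q"
    unfolding Q_def by (rule prob_space.real_distribution_distr[OF prob_space_measure_pmf]) simp
  obtain U where U: "U \<in> measurable M (restrict_space lborel {0<..<1::real})"
    and D: "distr M (restrict_space lborel {0<..<1}) U = restrict_space lborel {0<..<1}"
    using nonatomicE[OF assms] by blast
  define Y where "Y = (\<lambda>\<omega>. quantile Q (U \<omega>))"
  have Y: "Y \<in> borel_measurable M" "distr M borel Y = Q"
    unfolding Y_def using distr_quantile[OF U D Q] by auto
  have fl: "(\<lambda>t::real. nat \<lfloor>t\<rfloor>) \<in> measurable borel (count_space UNIV)"
    by measurable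
  have "(\<lambda>\<omega>. nat \<lfloor>Y \<omega>\<rfloor>) \<in> measurable M (count_space UNIV)"
    using measurable_compose[OF Y(1) fl] .
  moreover have "distr M (count_space UNIV) (\<lambda>\<omega>. nat \<lfloor>Y \<omega>\<rfloor>) = measure_pmf q"
  proof -
    have "distr M (count_space UNIV) (\<lambda>\<omega>. nat \<lfloor>Y \<omega>\<rfloor>)
        = distr (distr M borel Y) (count_space UNIV) (\<lambda>t. nat \<lfloor>t\<rfloor>)"
      using distr_distr[OF fl Y(1)] by (simp add: comp_def)
    also have "\<dots> = distr (measure_pmf q) (count_space UNIV) (\<lambda>i. i)"
      unfolding Y(2) Q_def by (subst distr_distr[OF fl]) (auto simp: comp_def)
    also have "\<dots> = measure_pmf q"
      by (rule distr_id2) simp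
    finally show ?thesis .
  qed
  ultimately show thesis by (rule that)
qed

section \<open>Integrability and convergence of sample means\<close>

text \<open>The lower power is dominated by \<open>1\<close> plus the higher one, and constants are
  integrable on a probability space.\<close>

lemma Lp_space_antimono:
  assumes "prob_space M" "0 < p" "p \<le> q" "f \<in> Lp_space M q"
  shows "f \<in> Lp_space M p"
proof -
  interpret prob_space M by fact
  have f: "f \<in> borel_measurable M" "integrable M (\<lambda>\<omega>. \<bar>f \<omega>\<bar> powr q)"
    using assms(4) by (auto simp: Lp_space_def)
  have bound: "\<bar>f \<omega>\<bar> powr p \<le> 1 + \<bar>f \<omega>\<bar> powr q" for \<omega>
  proof (cases "\<bar>f \<omega>\<bar> \<le> 1")
    case True
    then have "\<bar>f \<omega>\<bar> powr p \<le> 1"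
      using assms(2) by (intro powr_le1) auto
    then show ?thesis by (simp add: add_increasing2)
  next
    case False
    then have "\<bar>f \<omega>\<bar> powr p \<le> \<bar>f \<omega>\<bar> powr q"
      using assms(3) by (intro powr_mono) auto
    then show ?thesis by simp
  qed
  have "integrable M (\<lambda>\<omega>. \<bar>f \<omega>\<bar> powr p)"
    by (rule Bochner_Integration.integrable_bound[of M "\<lambda>\<omega>. 1 + \<bar>f \<omega>\<bar> powr q", rotated 2])
      (use f bound in auto)
  then show ?thesis using f by (simp add: Lp_space_def)
qed

lemma Lp_space_bound:
  assumes "0 \<le> p" "g \<in> Lp_space M p" "f \<in> borel_measurable M" "\<And>\<omega>. \<omega> \<in> space M \<Longrightarrow> \<bar>f \<omega>\<bar> \<le> \<bar>g \<omega>\<bar>"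
  shows "f \<in> Lp_space M p"
  using assms unfolding Lp_space_def
  by (auto intro!: Bochner_Integration.integrable_bound[of M "\<lambda>\<omega>. \<bar>g \<omega>\<bar> powr p"] powr_mono2 AE_I2)

text \<open>The conclusion of the assumed law of large numbers for one fixed sample sequence
  \<open>z\<close>. Working with it keeps all estimates deterministic in the sample until the final
  theorem.\<close>

definition means_converge ::
  "'a measure \<Rightarrow> ('a \<Rightarrow> 'x) \<Rightarrow> (nat \<Rightarrow> 'x) \<Rightarrow> ('x \<Rightarrow> real) \<Rightarrow> bool" where
  "means_converge M \<xi> z g \<longleftrightarrow>
    (\<lambda>N. (1 / real N) * (\<Sum>i=1..N. g (z i))) \<longlonglongrightarrow> (\<integral>\<omega>. (g \<circ> \<xi>) \<omega> \<partial>M)"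

text \<open>Since \<open>p * (1 + \<epsilon> / p) = p + \<epsilon>\<close>, the moment condition on
  \<open>k\<close> is exactly what the \<open>p\<close>-th power of a multiple of \<open>k\<close>
  needs to be admissible in the law of large numbers.\<close>

lemma Lp_space_of_powr_bound:
  assumes g: "g \<in> borel_measurable M" and k: "k \<in> Lp_space M (p + \<epsilon>)"
    and p: "0 < p" "0 \<le> \<epsilon>" and C: "0 \<le> C"
    and le: "\<And>\<omega>. \<omega> \<in> space M \<Longrightarrow> \<bar>g \<omega>\<bar> \<le> (C * \<bar>k \<omega>\<bar>) powr p"
  shows "g \<in> Lp_space M (1 + \<epsilon> / p)"
proof -
  have "(1 + \<epsilon> / p) * p = p + \<epsilon>"
    using p by (simp add: field_simps)
  then have eq: "((C * \<bar>k \<omega>\<bar>) powr p) powr (1 + \<epsilon> / p) = C powr (p + \<epsilon>) * \<bar>k \<omega>\<bar> powr (p + \<epsilon>)" for \<omega>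
    using C by (simp add: powr_powr powr_mult mult.commute)
  have "(\<lambda>\<omega>. (C * \<bar>k \<omega>\<bar>) powr p) \<in> Lp_space M (1 + \<epsilon> / p)"
    using k unfolding Lp_space_def by (auto simp: eq)
  then show ?thesis
    using p le by (intro Lp_space_bound[OF _ _ g]) auto
qed

lemma Lp_space_1_iff: "f \<in> Lp_space M 1 \<longleftrightarrow> integrable M f"
proof
  assume "f \<in> Lp_space M 1"
  then have "f \<in> borel_measurable M" "integrable M (\<lambda>\<omega>. \<bar>f \<omega>\<bar>)"
    by (simp_all add: Lp_space_def)
  then show "integrable M f"
    by (rule integrable_abs_cancel[rotated])
next
  assume "integrable M f"
  then show "f \<in> Lp_space M 1"
    by (simp add: Lp_space_def)
qed

section \<open>Coupling estimates for law invariant Lipschitz functionals\<close>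

text \<open>Treats a single coordinate: \<open>\<rho>\<close> stands for one
  \<open>\<rho> j\<close>, and the Lipschitz constant \<open>L\<close> is fixed so that estimates
  can refer to it.\<close>

locale Lp_risk = prob_space M for M :: "'a measure" +
  fixes p L :: real and \<rho> :: "('a \<Rightarrow> real) \<Rightarrow> real"
  assumes nonatomic: "nonatomic M"
    and p_ge_1: "1 \<le> p"
    and law_inv: "law_invariant M p \<rho>"
    and L_nonneg: "0 \<le> L"
    and Lipschitz: "\<And>Y Z. Y \<in> Lp_space M p \<Longrightarrow> Z \<in> Lp_space M p \<Longrightarrow>
      \<bar>\<rho> Y - \<rho> Z\<bar> \<le> L * Lp_norm M p (\<lambda>\<omega>. Y \<omega> - Z \<omega>)"
begin

abbreviation risk :: "real measure \<Rightarrow> real" where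
  "risk \<equiv> risk_of_distribution M p \<rho>"

lemma risk_distr:
  assumes "Y \<in> Lp_space M p"
  shows "risk (distr M borel Y) = \<rho> Y"
  using risk_of_distribution_distr[OF law_inv assms] .

text \<open>Both empirical laws are realised on \<open>M\<close> through one index drawn uniformly from \<open>{1..N}\<close>.\<close>

lemma risk_empirical_diff_le:
  assumes N: "N \<ge> 1" and f: "f \<in> borel_measurable borel" and g: "g \<in> borel_measurable borel"
  shows "\<bar>risk (distr (empirical_measure z N) borel f) - risk (distr (empirical_measure z N) borel g)\<bar>
    \<le> L * ((1 / real N) * (\<Sum>i=1..N. \<bar>f (z i) - g (z i)\<bar> powr p)) powr (1 / p)"
proof -
  let ?q = "pmf_of_set {1..N}"
  have sq: "finite (set_pmf ?q)" "{1..N} \<noteq> {}"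
    using N by auto
  obtain J where J: "J \<in> measurable M (count_space UNIV)"
    and DJ: "distr M (count_space UNIV) J = measure_pmf ?q"
    using nonatomic_distr_nat[OF nonatomic] by blast
  have int: "integrable M (\<lambda>\<omega>. h (J \<omega>))"
    "integral\<^sup>L M (\<lambda>\<omega>. h (J \<omega>)) = (1 / real N) * (\<Sum>i=1..N. h i)" for h :: "nat \<Rightarrow> real"
  proof -
    have "integrable (distr M (count_space UNIV) J) h"
      unfolding DJ by (rule integrable_measure_pmf_finite[OF sq(1)])
    then show "integrable M (\<lambda>\<omega>. h (J \<omega>))"
      by (subst (asm) integrable_distr_eq) (use J in auto)
    have "integral\<^sup>L M (\<lambda>\<omega>. h (J \<omega>)) = integral\<^sup>L (distr M (count_space UNIV) J) h"
      by (subst integral_distr) (use J in auto)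
    also have "\<dots> = (1 / real N) * (\<Sum>i=1..N. h i)"
      unfolding DJ using sq by (simp add: integral_pmf_of_set)
    finally show "integral\<^sup>L M (\<lambda>\<omega>. h (J \<omega>)) = \<dots>" .
  qed
  have meas: "(\<lambda>\<omega>. h (J \<omega>)) \<in> borel_measurable M" for h :: "nat \<Rightarrow> real"
    by (rule measurable_compose[OF J]) simp
  \<comment> \<open>Almost surely \<open>J\<close> takes finitely many values, so every function of
    it has all moments.\<close>
  have Lp: "(\<lambda>\<omega>. h (J \<omega>)) \<in> Lp_space M p" for h :: "nat \<Rightarrow> real"
    unfolding Lp_space_def using meas int(1)[of "\<lambda>i. \<bar>h i\<bar> powr p"] by auto
  have law: "distr (empirical_measure z N) borel h = distr M borel (\<lambda>\<omega>. h (z (J \<omega>)))"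
    if h: "h \<in> borel_measurable borel" for h :: "'b::topological_space \<Rightarrow> real" and z
  proof -
    have "distr (empirical_measure z N) borel h = distr (measure_pmf ?q) borel (\<lambda>i. h (z i))"
      using N h by (simp add: empirical_measure_eq_distr distr_distr comp_def)
    also have "\<dots> = distr M borel (\<lambda>\<omega>. h (z (J \<omega>)))"
      unfolding DJ[symmetric] by (subst distr_distr[OF _ J]) (auto simp: comp_def)
    finally show ?thesis .
  qed
  have "\<bar>\<rho> (\<lambda>\<omega>. f (z (J \<omega>))) - \<rho> (\<lambda>\<omega>. g (z (J \<omega>)))\<bar>
      \<le> L * Lp_norm M p (\<lambda>\<omega>. f (z (J \<omega>)) - g (z (J \<omega>)))"
    by (rule Lipschitz[OF Lp[of "\<lambda>i. f (z i)"] Lp[of "\<lambda>i. g (z i)"]])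
  also have "Lp_norm M p (\<lambda>\<omega>. f (z (J \<omega>)) - g (z (J \<omega>)))
      = ((1 / real N) * (\<Sum>i=1..N. \<bar>f (z i) - g (z i)\<bar> powr p)) powr (1 / p)"
    unfolding Lp_norm_def int(2)[of "\<lambda>i. \<bar>f (z i) - g (z i)\<bar> powr p"] ..
  finally show ?thesis
    unfolding law[OF f] law[OF g]
    using risk_distr[OF Lp[of "\<lambda>i. f (z i)"]] risk_distr[OF Lp[of "\<lambda>i. g (z i)"]] by simp
qed

text \<open>
  For finitely supported laws, convergence of the distribution functions makes the quantile
  transforms of one uniform variable eventually constant almost surely.
\<close>

lemma risk_tendsto_of_finite_support:
  assumes Qn: "\<And>n. real_distribution (Q n)" and Q': "real_distribution Q'"
    and S: "finite S" "\<And>n. measure (Q n) S = 1" "measure Q' S = 1"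
    and cdf: "\<And>y. y \<in> S \<Longrightarrow> (\<lambda>n. cdf (Q n) y) \<longlonglongrightarrow> cdf Q' y"
  shows "(\<lambda>n. risk (Q n)) \<longlonglongrightarrow> risk Q'"
proof -
  obtain U where U: "U \<in> measurable M (restrict_space lborel {0<..<1::real})"
    and D: "distr M (restrict_space lborel {0<..<1}) U = restrict_space lborel {0<..<1}"
    and U01: "\<And>\<omega>. \<omega> \<in> space M \<Longrightarrow> 0 < U \<omega> \<and> U \<omega> < 1"
    using nonatomicE[OF nonatomic] by blast
  define Y where "Y Q \<omega> = quantile Q (U \<omega>)" for Q \<omega>
  have Y: "Y Q \<in> borel_measurable M" "distr M borel (Y Q) = Q" if "real_distribution Q" for Q
    unfolding Y_def[abs_def] using distr_quantile[OF U D that] by auto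
  have Sb: "S \<in> sets borel"
    using S(1) by (simp add: finite_imp_closed borel_closed)
  have AE_S: "AE \<omega> in M. Y Q \<omega> \<in> S" if "real_distribution Q" "measure Q S = 1" for Q
  proof -
    have "prob (Y Q -` S \<inter> space M) = 1"
      using Y[OF that(1)] that(2) Sb by (metis measure_distr)
    moreover have "Y Q -` S \<inter> space M \<in> events"
      using Y(1)[OF that(1)] Sb by (rule measurable_sets)
    ultimately show ?thesis
      by (subst (asm) prob_eq_1) auto
  qed
  obtain b where b: "\<And>y. y \<in> S \<Longrightarrow> \<bar>y\<bar> \<le> b"
    using finite_imp_bounded[OF S(1)] unfolding bounded_iff by (metis real_norm_def)
  have Lp: "Y Q \<in> Lp_space M p" if "real_distribution Q" "measure Q S = 1" for Q
  proof -
    have "integrable M (\<lambda>\<omega>. \<bar>Y Q \<omega>\<bar> powr p)"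
    proof (rule integrable_const_bound)
      show "AE \<omega> in M. norm (\<bar>Y Q \<omega>\<bar> powr p) \<le> b powr p"
        using AE_S[OF that] by eventually_elim (use b p_ge_1 in \<open>auto intro: powr_mono2\<close>)
      show "(\<lambda>\<omega>. \<bar>Y Q \<omega>\<bar> powr p) \<in> borel_measurable M"
        using Y(1)[OF that(1)] by measurable
    qed
    then show ?thesis using Y(1)[OF that(1)] by (simp add: Lp_space_def)
  qed
  \<comment> \<open>A uniform variable has no atoms. The levels to avoid are the values
    \<open>cdf Q' y\<close>, at which convergence of the distribution functions would not decide the
    comparison with \<open>U\<close>.\<close>
  have "AE \<omega> in M. U \<omega> \<noteq> c" for c
  proof -
    have "AE u in restrict_space lborel {0<..<1::real}. u \<noteq> c"
      using AE_lborel_singleton[of c] by (subst AE_restrict_space_iff) auto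
    then have "AE u in distr M (restrict_space lborel {0<..<1}) U. u \<noteq> c"
      unfolding D .
    then show ?thesis
      by (rule AE_distrD[OF U])
  qed
  then have "AE \<omega> in M. \<forall>y\<in>S. U \<omega> \<noteq> cdf Q' y"
    by (intro AE_finite_allI[OF S(1)]) auto
  moreover have "AE \<omega> in M. \<forall>n. Y (Q n) \<omega> \<in> S"
    using AE_S[OF Qn S(2)] by (subst AE_all_countable) auto
  moreover have "AE \<omega> in M. Y Q' \<omega> \<in> S"
    using AE_S[OF Q' S(3)] .
  moreover have "AE \<omega> in M. \<omega> \<in> space M"
    by (rule AE_space)
  ultimately have conv: "AE \<omega> in M. (\<lambda>n. \<bar>Y (Q n) \<omega> - Y Q' \<omega>\<bar> powr p) \<longlonglongrightarrow> 0"
  proof eventually_elim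
    case (elim \<omega>)
    have "\<forall>\<^sub>F n in sequentially. (U \<omega> \<le> cdf (Q n) y) = (U \<omega> \<le> cdf Q' y)" if "y \<in> S" for y
    proof (cases "U \<omega> < cdf Q' y")
      case True
      from order_tendstoD(1)[OF cdf[OF that] this] show ?thesis
        by eventually_elim (use True in auto)
    next
      case False
      \<comment> \<open>Equality has been excluded, so in either case a strict inequality is
        inherited by \<open>cdf (Q n) y\<close> for large \<open>n\<close>.\<close>
      then have *: "cdf Q' y < U \<omega>"
        using elim(1) that by force
      from order_tendstoD(2)[OF cdf[OF that] this] show ?thesis
        by eventually_elim (use * in auto)
    qed
    then have "\<forall>\<^sub>F n in sequentially. \<forall>y\<in>S. (U \<omega> \<le> cdf (Q n) y) = (U \<omega> \<le> cdf Q' y)"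
      using S(1) by (simp add: eventually_ball_finite)
    then have "\<forall>\<^sub>F n in sequentially. Y (Q n) \<omega> = Y Q' \<omega>"
    proof eventually_elim
      case (elim n)
      \<comment> \<open>Both quantiles lie in \<open>S\<close> and are below the same points of
        \<open>S\<close>; testing each against the other forces equality.\<close>
      have "Y (Q n) \<omega> \<le> y \<longleftrightarrow> Y Q' \<omega> \<le> y" if "y \<in> S" for y
        using elim that U01[OF \<open>\<omega> \<in> space M\<close>] quantile_le_iff[OF Qn] quantile_le_iff[OF Q']
        unfolding Y_def by auto
      then show ?case
        using \<open>\<forall>n. Y (Q n) \<omega> \<in> S\<close> \<open>Y Q' \<omega> \<in> S\<close> by (metis order.antisym order.refl)
    qed
    then have "\<forall>\<^sub>F n in sequentially. \<bar>Y (Q n) \<omega> - Y Q' \<omega>\<bar> powr p = 0"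
      by eventually_elim simp
    then show ?case by (rule tendsto_eventually)
  qed
  have "(\<lambda>n. integral\<^sup>L M (\<lambda>\<omega>. \<bar>Y (Q n) \<omega> - Y Q' \<omega>\<bar> powr p)) \<longlonglongrightarrow> integral\<^sup>L M (\<lambda>\<omega>. 0::real)"
  proof (rule integral_dominated_convergence)
    show "AE \<omega> in M. norm (\<bar>Y (Q n) \<omega> - Y Q' \<omega>\<bar> powr p) \<le> (2 * b) powr p" for n
      using AE_S[OF Qn S(2), of n] AE_S[OF Q' S(3)]
    proof eventually_elim
      case (elim \<omega>)
      have "\<bar>Y (Q n) \<omega> - Y Q' \<omega>\<bar> \<le> 2 * b"
        using b[OF elim(1)] b[OF elim(2)] by linarith
      then show ?case using p_ge_1 by (auto intro: powr_mono2)
    qed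
    show "AE \<omega> in M. (\<lambda>n. \<bar>Y (Q n) \<omega> - Y Q' \<omega>\<bar> powr p) \<longlonglongrightarrow> 0"
      by (rule conv)
    show "(\<lambda>\<omega>. \<bar>Y (Q n) \<omega> - Y Q' \<omega>\<bar> powr p) \<in> borel_measurable M" for n
      using Y(1)[OF Qn, of n] Y(1)[OF Q'] by measurable
  qed auto
  then have "(\<lambda>n. integral\<^sup>L M (\<lambda>\<omega>. \<bar>Y (Q n) \<omega> - Y Q' \<omega>\<bar> powr p)) \<longlonglongrightarrow> 0"
    by simp
  \<comment> \<open>The integrals are nonnegative and \<open>1 / p\<close> is positive, so the root
    may be passed to the limit at \<open>0\<close>.\<close>
  then have "(\<lambda>n. L * Lp_norm M p (\<lambda>\<omega>. Y (Q n) \<omega> - Y Q' \<omega>)) \<longlonglongrightarrow> L * 0 powr (1 / p)"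
    unfolding Lp_norm_def
    by (intro tendsto_mult tendsto_const tendsto_powr2) (use p_ge_1 in auto)
  then have "(\<lambda>n. L * Lp_norm M p (\<lambda>\<omega>. Y (Q n) \<omega> - Y Q' \<omega>)) \<longlonglongrightarrow> 0"
    by simp
  then have "(\<lambda>n. \<rho> (Y (Q n)) - \<rho> (Y Q')) \<longlonglongrightarrow> 0"
    by (rule Lim_null_comparison[rotated])
       (use Lipschitz[OF Lp[OF Qn S(2)] Lp[OF Q' S(3)]] in auto)
  then have "(\<lambda>n. \<rho> (Y (Q n))) \<longlonglongrightarrow> \<rho> (Y Q')"
    by (rule LIM_zero_cancel)
  moreover have "\<rho> (Y Q) = risk Q" if "real_distribution Q" "measure Q S = 1" for Q
    using risk_distr[OF Lp[OF that]] Y(2)[OF that(1)] by simp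
  ultimately show ?thesis
    using Qn Q' S by simp
qed


section \<open>From simple functions to general integrands\<close>

text \<open>A three-term estimate: exchanging \<open>f k\<close> for \<open>g\<close> costs at most
  a root of the empirical mean of \<open>G\<close>, exchanging \<open>f0\<close> for
  \<open>g\<close> a root of its integral, and the risks of \<open>g\<close> converge. One
  \<open>G\<close> dominates the errors for all large \<open>k\<close>, so a single convergence of
  means suffices although \<open>f k\<close> varies.\<close>

lemma empirical_risk_tendsto_of_approx:
  fixes \<xi> :: "'a \<Rightarrow> 'x::topological_space"
  assumes \<xi>: "\<xi> \<in> measurable M borel"
    and N: "\<And>k. N k \<ge> 1" "filterlim N at_top sequentially"
    and f: "\<And>k. f k \<in> borel_measurable borel"
    and f0: "f0 \<circ> \<xi> \<in> Lp_space M p"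
    and approx: "\<And>e. e > 0 \<Longrightarrow> \<exists>g G. g \<in> borel_measurable borel \<and> g \<circ> \<xi> \<in> Lp_space M p \<and>
      (\<lambda>k. risk (distr (empirical_measure z (N k)) borel g)) \<longlonglongrightarrow> \<rho> (g \<circ> \<xi>) \<and>
      means_converge M \<xi> z G \<and> integrable M (G \<circ> \<xi>) \<and> integral\<^sup>L M (G \<circ> \<xi>) < e \<and>
      (\<forall>\<upsilon>. \<bar>f0 \<upsilon> - g \<upsilon>\<bar> powr p \<le> G \<upsilon>) \<and>
      (\<forall>\<^sub>F k in sequentially. \<forall>\<upsilon>. \<bar>f k \<upsilon> - g \<upsilon>\<bar> powr p \<le> G \<upsilon>)"
  shows "(\<lambda>k. risk (distr (empirical_measure z (N k)) borel (f k))) \<longlonglongrightarrow> \<rho> (f0 \<circ> \<xi>)"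
proof (rule tendstoI)
  fix \<eta> :: real assume \<eta>: "\<eta> > 0"
  \<comment> \<open>The summand \<open>1\<close> avoids division by zero when \<open>L = 0\<close>
    and makes \<open>L * \<delta> < \<eta> / 3\<close> strict; \<open>e\<close> is then chosen with
    \<open>p\<close>-th root \<open>\<delta>\<close>.\<close>
  define \<delta> where "\<delta> = \<eta> / (3 * (L + 1))"
  have \<delta>: "\<delta> > 0" "L * \<delta> < \<eta> / 3"
    using \<eta> L_nonneg by (auto simp: \<delta>_def field_simps)
  define e where "e = \<delta> powr p"
  have e: "e > 0" "e powr (1 / p) = \<delta>"
    using \<delta> p_ge_1 by (auto simp: e_def powr_powr)
  from approx[OF e(1)] obtain g G where
    g: "g \<in> borel_measurable borel" "g \<circ> \<xi> \<in> Lp_space M p"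
      "(\<lambda>k. risk (distr (empirical_measure z (N k)) borel g)) \<longlonglongrightarrow> \<rho> (g \<circ> \<xi>)"
    and G: "means_converge M \<xi> z G" "integrable M (G \<circ> \<xi>)" "integral\<^sup>L M (G \<circ> \<xi>) < e"
    and le0: "\<And>\<upsilon>. \<bar>f0 \<upsilon> - g \<upsilon>\<bar> powr p \<le> G \<upsilon>"
    and le: "\<forall>\<^sub>F k in sequentially. \<forall>\<upsilon>. \<bar>f k \<upsilon> - g \<upsilon>\<bar> powr p \<le> G \<upsilon>"
    by blast
  have root: "L * t powr (1 / p) < \<eta> / 3" if "0 \<le> t" "t \<le> e" for t
  proof -
    have "t powr (1 / p) \<le> e powr (1 / p)"
      using that p_ge_1 by (intro powr_mono2) auto
    then have "L * t powr (1 / p) \<le> L * \<delta>"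
      unfolding e(2) using L_nonneg by (rule mult_left_mono)
    then show ?thesis using \<delta>(2) by linarith
  qed
  have "integral\<^sup>L M (\<lambda>\<omega>. \<bar>(f0 \<circ> \<xi>) \<omega> - (g \<circ> \<xi>) \<omega>\<bar> powr p) \<le> integral\<^sup>L M (G \<circ> \<xi>)"
  proof (rule integral_mono')
    show "\<bar>(f0 \<circ> \<xi>) \<omega> - (g \<circ> \<xi>) \<omega>\<bar> powr p \<le> (G \<circ> \<xi>) \<omega>" for \<omega>
      using le0 by simp
    then show "0 \<le> (G \<circ> \<xi>) \<omega>" for \<omega>
      by (rule order_trans[rotated]) simp
  qed (rule G(2))
  then have "integral\<^sup>L M (\<lambda>\<omega>. \<bar>(f0 \<circ> \<xi>) \<omega> - (g \<circ> \<xi>) \<omega>\<bar> powr p) \<le> e"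
    using G(3) by linarith
  then have "L * Lp_norm M p (\<lambda>\<omega>. (f0 \<circ> \<xi>) \<omega> - (g \<circ> \<xi>) \<omega>) < \<eta> / 3"
    unfolding Lp_norm_def by (intro root) simp_all
  then have "\<bar>\<rho> (f0 \<circ> \<xi>) - \<rho> (g \<circ> \<xi>)\<bar> < \<eta> / 3"
    using Lipschitz[OF f0 g(2)] by linarith
  then have D1: "\<bar>\<rho> (g \<circ> \<xi>) - \<rho> (f0 \<circ> \<xi>)\<bar> < \<eta> / 3" by linarith
  have "\<eta> / 3 > 0"
    using \<eta> by simp
  have "(\<lambda>k. (1 / real (N k)) * (\<Sum>i=1..N k. G (z i))) \<longlonglongrightarrow> integral\<^sup>L M (G \<circ> \<xi>)"
    using filterlim_compose[OF G(1)[unfolded means_converge_def] N(2)] .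
  from order_tendstoD(2)[OF this G(3)] le tendstoD[OF g(3) \<open>\<eta> / 3 > 0\<close>]
  show "\<forall>\<^sub>F k in sequentially.
      dist (risk (distr (empirical_measure z (N k)) borel (f k))) (\<rho> (f0 \<circ> \<xi>)) < \<eta>"
  proof eventually_elim
    case (elim k)
    let ?S = "(1 / real (N k)) * (\<Sum>i=1..N k. \<bar>f k (z i) - g (z i)\<bar> powr p)"
    have "?S \<le> (1 / real (N k)) * (\<Sum>i=1..N k. G (z i))"
      using elim(2) by (intro mult_left_mono sum_mono) auto
    then have "?S \<le> e" using elim(1) by linarith
    moreover have "0 \<le> ?S"
      by (intro mult_nonneg_nonneg sum_nonneg) auto
    ultimately have "\<bar>risk (distr (empirical_measure z (N k)) borel (f k))
        - risk (distr (empirical_measure z (N k)) borel g)\<bar> < \<eta> / 3"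
      using risk_empirical_diff_le[OF N(1) f g(1), where z = z, of k k] root[of ?S] by linarith
    moreover have "\<bar>risk (distr (empirical_measure z (N k)) borel g) - \<rho> (g \<circ> \<xi>)\<bar> < \<eta> / 3"
      using elim(3) \<eta> by (simp add: dist_real_def)
    ultimately show ?case
      using D1 unfolding dist_real_def by linarith
  qed
qed

text \<open>All laws are carried by the finite set \<open>range s\<close>, and their distribution
  functions at its points are means or integrals of indicators, so
  \<open>risk_tendsto_of_finite_support\<close> applies.\<close>

lemma empirical_risk_tendsto_simple:
  fixes \<xi> :: "'a \<Rightarrow> 'x::topological_space"
  assumes \<xi>: "\<xi> \<in> measurable M borel"
    and N: "\<And>k. N k \<ge> 1" "filterlim N at_top sequentially"
    and s: "s \<in> borel_measurable borel" "finite (range s)"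
    and conv: "\<And>y. y \<in> range s \<Longrightarrow> means_converge M \<xi> z (indicator {\<upsilon>. s \<upsilon> \<le> y})"
  shows "(\<lambda>k. risk (distr (empirical_measure z (N k)) borel s)) \<longlonglongrightarrow> \<rho> (s \<circ> \<xi>)"
    and "s \<circ> \<xi> \<in> Lp_space M p"
proof -
  have s\<xi>: "s \<circ> \<xi> \<in> borel_measurable M"
    using \<xi> s(1) by measurable
  obtain b where b: "\<And>\<upsilon>. \<bar>s \<upsilon>\<bar> \<le> b"
    using finite_imp_bounded[OF s(2)] unfolding bounded_iff by (metis real_norm_def rangeI)
  have "(\<lambda>_. b) \<in> Lp_space M p"
    by (simp add: Lp_space_def)
  moreover have "\<bar>(s \<circ> \<xi>) \<omega>\<bar> \<le> \<bar>b\<bar>" for \<omega>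
    using b[of "\<xi> \<omega>"] by simp
  ultimately show Lp: "s \<circ> \<xi> \<in> Lp_space M p"
    by (intro Lp_space_bound[OF _ _ s\<xi>, of p "\<lambda>_. b"]) (use p_ge_1 in auto)
  have Sb: "range s \<in> sets borel"
    using s(2) by (simp add: finite_imp_closed borel_closed)
  have "(\<lambda>k. risk (distr (empirical_measure z (N k)) borel s)) \<longlonglongrightarrow> risk (distr M borel (s \<circ> \<xi>))"
  proof (rule risk_tendsto_of_finite_support[OF _ _ s(2)])
    show "real_distribution (distr (empirical_measure z (N k)) borel s)" for k
    proof (rule prob_space.real_distribution_distr)
      show "prob_space (empirical_measure z (N k))"
        using N(1) by (rule prob_space_empirical_measure)
      show "s \<in> borel_measurable (empirical_measure z (N k))"
        using s(1) by (simp cong: measurable_cong_sets)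
    qed
    show "real_distribution (distr M borel (s \<circ> \<xi>))"
      using s\<xi> by simp
    show "measure (distr (empirical_measure z (N k)) borel s) (range s) = 1" for k
      using N(1)[of k] by (subst measure_distr_empirical_measure[OF N(1) s(1) Sb]) simp
    show "measure (distr M borel (s \<circ> \<xi>)) (range s) = 1"
      using prob_space by (subst measure_distr[OF s\<xi>]) (auto simp: s(2) Sb vimage_def)
    fix y assume y: "y \<in> range s"
    have "(\<lambda>k. (1 / real (N k)) * (\<Sum>i=1..N k. indicator {\<upsilon>. s \<upsilon> \<le> y} (z i)))
        \<longlonglongrightarrow> (\<integral>\<omega>. (indicator {\<upsilon>. s \<upsilon> \<le> y} \<circ> \<xi>) \<omega> \<partial>M)"
      using filterlim_compose[OF conv[OF y, unfolded means_converge_def] N(2)] .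
    moreover have "cdf (distr (empirical_measure z (N k)) borel s) y
        = (1 / real (N k)) * (\<Sum>i=1..N k. indicator {\<upsilon>. s \<upsilon> \<le> y} (z i))" for k
      unfolding cdf_def
      by (subst measure_distr_empirical_measure[OF N(1) s(1)]) (auto simp: vimage_def)
    moreover have "(\<integral>\<omega>. (indicator {\<upsilon>. s \<upsilon> \<le> y} \<circ> \<xi>) \<omega> \<partial>M) = cdf (distr M borel (s \<circ> \<xi>)) y"
    proof -
      have "(\<integral>\<omega>. (indicator {\<upsilon>. s \<upsilon> \<le> y} \<circ> \<xi>) \<omega> \<partial>M)
          = (\<integral>\<omega>. indicator ((s \<circ> \<xi>) -` {..y} \<inter> space M) \<omega> \<partial>M)"
        by (intro Bochner_Integration.integral_cong) (auto simp: indicator_def)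
      also have "\<dots> = prob ((s \<circ> \<xi>) -` {..y} \<inter> space M)"
        by simp
      also have "\<dots> = cdf (distr M borel (s \<circ> \<xi>)) y"
        unfolding cdf_def by (subst measure_distr[OF s\<xi>]) auto
      finally show ?thesis .
    qed
    ultimately show "(\<lambda>k. cdf (distr (empirical_measure z (N k)) borel s) y)
        \<longlonglongrightarrow> cdf (distr M borel (s \<circ> \<xi>)) y"
      by simp
  qed
  then show "(\<lambda>k. risk (distr (empirical_measure z (N k)) borel s)) \<longlonglongrightarrow> \<rho> (s \<circ> \<xi>)"
    using risk_distr[OF Lp] by simp
qed


section \<open>Countable families of test functions\<close>

context
  fixes \<xi> :: "'a \<Rightarrow> 'x::topological_space" and \<epsilon> :: real and \<kappa> :: "'x \<Rightarrow> real"
  assumes \<xi>: "\<xi> \<in> measurable M borel"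
    and \<epsilon>: "0 \<le> \<epsilon>"
    and \<kappa>: "\<kappa> \<in> borel_measurable borel" "\<kappa> \<circ> \<xi> \<in> Lp_space M (p + \<epsilon>)"
begin

lemma dominated_Lp:
  assumes "f \<in> borel_measurable borel" "\<And>\<upsilon>. \<bar>f \<upsilon>\<bar> \<le> \<kappa> \<upsilon>"
  shows "f \<circ> \<xi> \<in> Lp_space M p"
proof (rule Lp_space_bound)
  show "\<kappa> \<circ> \<xi> \<in> Lp_space M p"
    by (rule Lp_space_antimono[OF prob_space_axioms _ _ \<kappa>(2)]) (use p_ge_1 \<epsilon> in auto)
  show "f \<circ> \<xi> \<in> borel_measurable M"
    using measurable_comp[OF \<xi> assms(1)] .
  show "\<bar>(f \<circ> \<xi>) \<omega>\<bar> \<le> \<bar>(\<kappa> \<circ> \<xi>) \<omega>\<bar>" for \<omega>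
    using assms(2)[of "\<xi> \<omega>"] by simp
qed (use p_ge_1 in simp)

text \<open>Criterion for test functions. The constant \<open>C\<close> accommodates differences of
  functions bounded by \<open>\<kappa>\<close> or its multiples.\<close>

lemma
  assumes g: "g \<in> borel_measurable borel" and C: "0 \<le> C" "\<And>\<upsilon>. \<bar>g \<upsilon>\<bar> \<le> (C * \<bar>\<kappa> \<upsilon>\<bar>) powr p"
  shows Lp_of_powr_dominated: "g \<circ> \<xi> \<in> Lp_space M (1 + \<epsilon> / p)"
    and integrable_of_powr_dominated: "integrable M (g \<circ> \<xi>)"
proof -
  have "g \<circ> \<xi> \<in> borel_measurable M"
    using measurable_comp[OF \<xi> g] .
  then show *: "g \<circ> \<xi> \<in> Lp_space M (1 + \<epsilon> / p)"
    by (rule Lp_space_of_powr_bound[OF _ \<kappa>(2) _ \<epsilon> C(1)]) (use p_ge_1 C in auto)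
  have "g \<circ> \<xi> \<in> Lp_space M 1"
    by (rule Lp_space_antimono[OF prob_space_axioms _ _ *]) (use p_ge_1 \<epsilon> in auto)
  then show "integrable M (g \<circ> \<xi>)"
    by (simp add: Lp_space_1_iff)
qed

text \<open>Dominated convergence with an integrable majorant built from \<open>\<kappa>\<close>; it
  supplies error functions of arbitrarily small integral.\<close>

lemma integral_tendsto_0_of_powr_dominated:
  fixes g :: "nat \<Rightarrow> 'x \<Rightarrow> real"
  assumes g: "\<And>n. g n \<in> borel_measurable borel"
    and C: "0 \<le> C" "\<And>n \<upsilon>. \<bar>g n \<upsilon>\<bar> \<le> (C * \<bar>\<kappa> \<upsilon>\<bar>) powr p"
    and lim: "\<And>\<upsilon>. (\<lambda>n. g n \<upsilon>) \<longlonglongrightarrow> 0"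
  shows "(\<lambda>n. integral\<^sup>L M (g n \<circ> \<xi>)) \<longlonglongrightarrow> 0"
proof -
  let ?w = "\<lambda>\<upsilon>. (C * \<bar>\<kappa> \<upsilon>\<bar>) powr p"
  have w: "integrable M (?w \<circ> \<xi>)"
    using \<kappa>(1) by (intro integrable_of_powr_dominated[OF _ C(1)]) auto
  have "(\<lambda>n. integral\<^sup>L M (g n \<circ> \<xi>)) \<longlonglongrightarrow> integral\<^sup>L M (\<lambda>\<omega>. 0::real)"
  proof (rule integral_dominated_convergence[OF _ _ w])
    show "g n \<circ> \<xi> \<in> borel_measurable M" for n
      using measurable_comp[OF \<xi> g] .
  qed (use C(2) lim in auto)
  then show ?thesis by simp
qed

text \<open>For a fixed integrand, the family consists of the indicators of sublevel sets of
  approximating simple functions, at their finitely many values, and of the \<open>p\<close>-th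
  powers of the approximation errors. It is chosen before \<open>z\<close> and \<open>N\<close>, so
  one null set can serve all subsequences.\<close>

lemma empirical_risk_test_functions:
  assumes h: "h \<in> borel_measurable borel" "\<And>\<upsilon>. \<bar>h \<upsilon>\<bar> \<le> \<kappa> \<upsilon>"
  shows "\<exists>H. countable H \<and>
    (\<forall>g\<in>H. g \<in> borel_measurable borel \<and> g \<circ> \<xi> \<in> Lp_space M (1 + \<epsilon> / p)) \<and>
    (\<forall>z N. (\<forall>g\<in>H. means_converge M \<xi> z g) \<longrightarrow> (\<forall>k. N k \<ge> 1) \<longrightarrow> filterlim N at_top sequentially \<longrightarrow>
      (\<lambda>k. risk (distr (empirical_measure z (N k)) borel h)) \<longlonglongrightarrow> \<rho> (h \<circ> \<xi>))"
proof -
  \<comment> \<open>With base point \<open>0\<close> the approximants obey \<open>\<bar>s i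
    \<upsilon>\<bar> \<le> 2 * \<bar>h \<upsilon>\<bar>\<close>, whence the factor \<open>3\<close>
    in \<open>G_le\<close>.\<close>
  from borel_measurable_implies_sequence_metric[OF h(1), of 0] obtain s where
    simple: "\<And>i. simple_function borel (s i)"
    and lim: "\<And>\<upsilon>. (\<lambda>i. s i \<upsilon>) \<longlonglongrightarrow> h \<upsilon>"
    and bound: "\<And>i \<upsilon>. \<bar>s i \<upsilon>\<bar> \<le> 2 * \<bar>h \<upsilon>\<bar>"
    by (auto simp: dist_real_def)
  have s [measurable]: "s i \<in> borel_measurable borel" and s_fin: "finite (range (s i))" for i
    using borel_measurable_simple_function[OF simple[of i]] simple_functionD(1)[OF simple[of i]]
    by simp_all
  define G where "G i \<upsilon> = \<bar>h \<upsilon> - s i \<upsilon>\<bar> powr p" for i \<upsilon>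
  have G [measurable]: "G i \<in> borel_measurable borel" for i
    unfolding G_def[abs_def] using h(1) by measurable
  have G_le: "\<bar>G i \<upsilon>\<bar> \<le> (3 * \<bar>\<kappa> \<upsilon>\<bar>) powr p" for i \<upsilon>
  proof -
    have "\<bar>h \<upsilon> - s i \<upsilon>\<bar> \<le> 3 * \<bar>\<kappa> \<upsilon>\<bar>"
      using bound[of i \<upsilon>] h(2)[of \<upsilon>] by linarith
    then show ?thesis
      unfolding G_def using p_ge_1 by (auto intro: powr_mono2)
  qed
  have G_lim: "(\<lambda>i. G i \<upsilon>) \<longlonglongrightarrow> 0" for \<upsilon>
  proof -
    have "(\<lambda>i. \<bar>h \<upsilon> - s i \<upsilon>\<bar>) \<longlonglongrightarrow> \<bar>h \<upsilon> - h \<upsilon>\<bar>"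
      by (intro tendsto_intros lim)
    then have "(\<lambda>i. G i \<upsilon>) \<longlonglongrightarrow> \<bar>h \<upsilon> - h \<upsilon>\<bar> powr p"
      unfolding G_def by (intro tendsto_powr2) (use p_ge_1 in auto)
    then show ?thesis by simp
  qed
  have G_int: "(\<lambda>i. integral\<^sup>L M (G i \<circ> \<xi>)) \<longlonglongrightarrow> 0"
    by (rule integral_tendsto_0_of_powr_dominated[OF G _ G_le G_lim]) simp
  define I where "I i y = (indicator {\<upsilon>. s i \<upsilon> \<le> y} :: 'x \<Rightarrow> real)" for i y
  have I: "I i y \<in> borel_measurable borel" "I i y \<circ> \<xi> \<in> Lp_space M (1 + \<epsilon> / p)" for i y
  proof -
    show m: "I i y \<in> borel_measurable borel"
      unfolding I_def by measurable
    show "I i y \<circ> \<xi> \<in> Lp_space M (1 + \<epsilon> / p)"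
    proof (rule Lp_space_bound[of _ "\<lambda>_. 1"])
      show "I i y \<circ> \<xi> \<in> borel_measurable M"
        using measurable_comp[OF \<xi> m] .
    qed (use \<epsilon> p_ge_1 in \<open>auto simp: Lp_space_def I_def indicator_def\<close>)
  qed
  define H where "H = (\<Union>i. I i ` range (s i)) \<union> range G"
  have H: "I i (s i \<upsilon>) \<in> H" "G i \<in> H" for i \<upsilon>
    by (auto simp: H_def)
  have "(\<lambda>k. risk (distr (empirical_measure z (N k)) borel h)) \<longlonglongrightarrow> \<rho> (h \<circ> \<xi>)"
    if mc: "\<forall>g\<in>H. means_converge M \<xi> z g"
      and N: "\<forall>k. N k \<ge> 1" "filterlim N at_top sequentially" for z N
  proof (rule empirical_risk_tendsto_of_approx[OF \<xi> _ N(2) h(1) dominated_Lp[OF h]])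
    fix e :: real assume "e > 0"
    with order_tendstoD(2)[OF G_int] obtain i where i: "integral\<^sup>L M (G i \<circ> \<xi>) < e"
      by (meson eventually_happens' sequentially_bot)
    have "means_converge M \<xi> z (indicator {\<upsilon>. s i \<upsilon> \<le> y})" if "y \<in> range (s i)" for y
      using that mc H(1)[of i] unfolding I_def by blast
    note simple = empirical_risk_tendsto_simple[OF \<xi> N(1)[rule_format] N(2) s s_fin this]
    have "(\<lambda>k. risk (distr (empirical_measure z (N k)) borel (s i))) \<longlonglongrightarrow> \<rho> (s i \<circ> \<xi>)"
      "s i \<circ> \<xi> \<in> Lp_space M p"
      by (rule simple; simp)+
    moreover have "integrable M (G i \<circ> \<xi>)"
      by (rule integrable_of_powr_dominated[OF G _ G_le]) simp
    ultimately show "\<exists>g G. g \<in> borel_measurable borel \<and> g \<circ> \<xi> \<in> Lp_space M p \<and>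
      (\<lambda>k. risk (distr (empirical_measure z (N k)) borel g)) \<longlonglongrightarrow> \<rho> (g \<circ> \<xi>) \<and>
      means_converge M \<xi> z G \<and> integrable M (G \<circ> \<xi>) \<and> integral\<^sup>L M (G \<circ> \<xi>) < e \<and>
      (\<forall>\<upsilon>. \<bar>h \<upsilon> - g \<upsilon>\<bar> powr p \<le> G \<upsilon>) \<and>
      (\<forall>\<^sub>F k in sequentially. \<forall>\<upsilon>. \<bar>h \<upsilon> - g \<upsilon>\<bar> powr p \<le> G \<upsilon>)"
      using i s[of i] mc H(2)[of i] by (intro exI[of _ "s i"] exI[of _ "G i"]) (auto simp: G_def)
  qed (use N(1) in auto)
  moreover have "countable (I i ` range (s i))" for i
    by (intro countable_image countable_finite s_fin)
  then have "countable H"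
    unfolding H_def by (intro countable_Un countable_UN) auto
  moreover have "G i \<circ> \<xi> \<in> Lp_space M (1 + \<epsilon> / p)" for i
    by (rule Lp_of_powr_dominated[OF G _ G_le]) simp
  then have "g \<in> borel_measurable borel \<and> g \<circ> \<xi> \<in> Lp_space M (1 + \<epsilon> / p)" if "g \<in> H" for g
    using that I G unfolding H_def by auto
  ultimately show ?thesis by blast
qed

text \<open>
  Moduli of continuity of \<open>F\<close> at the countably many scales \<open>1 / Suc m\<close> are test functions whose
  means vanish as \<open>m\<close> grows, so \<open>F a\<close> can be traded for \<open>F d\<close> with \<open>d\<close> in a countable dense set.
\<close>

lemma empirical_risk_test_functions_parametric:
  fixes X :: "'b::{metric_space, second_countable_topology} set"
  assumes X: "compact X" and F: "caratheodory_on X F"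
    and bound: "\<And>y \<upsilon>. y \<in> X \<Longrightarrow> \<bar>F y \<upsilon>\<bar> \<le> \<kappa> \<upsilon>"
  shows "\<exists>H. countable H \<and>
    (\<forall>g\<in>H. g \<in> borel_measurable borel \<and> g \<circ> \<xi> \<in> Lp_space M (1 + \<epsilon> / p)) \<and>
    (\<forall>z N u a. (\<forall>g\<in>H. means_converge M \<xi> z g) \<longrightarrow> (\<forall>k. N k \<ge> 1) \<longrightarrow>
      filterlim N at_top sequentially \<longrightarrow> (\<forall>k. u k \<in> X) \<longrightarrow> u \<longlonglongrightarrow> a \<longrightarrow>
      (\<lambda>k. risk (distr (empirical_measure z (N k)) borel (F (u k)))) \<longlonglongrightarrow> \<rho> (F a \<circ> \<xi>))"
proof (cases "X = {}")
  \<comment> \<open>No sequence lies in an empty \<open>X\<close>; the other case has nonempty index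
    sets for the suprema below.\<close>
  case True
  then show ?thesis by (intro exI[of _ "{}"]) auto
next
  case False
  have F_meas: "F y \<in> borel_measurable borel" if "y \<in> X" for y
    using F that by (simp add: caratheodory_on_def)
  have F_cont: "continuous_on X (\<lambda>y. F y \<upsilon>)" for \<upsilon>
    using F by (simp add: caratheodory_on_def)
  obtain D where D: "countable D" "D \<subseteq> X" "X \<subseteq> closure D"
    using separable[of X] by blast
  then have "D \<noteq> {}" using False by auto
  \<comment> \<open>Only points of the countable set \<open>D\<close> are paired, so the supremum
    \<open>G m\<close> is countable and hence measurable.\<close>
  define P where "P m = {(y, y') \<in> D \<times> D. dist y y' < 1 / real (Suc m)}" for m
  define G where "G m \<upsilon> = (SUP (y, y')\<in>P m. \<bar>F y \<upsilon> - F y' \<upsilon>\<bar> powr p)" for m \<upsilon>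
  have P: "P m \<noteq> {}" "countable (P m)" for m
  proof -
    obtain d where "d \<in> D" using \<open>D \<noteq> {}\<close> by blast
    then have "(d, d) \<in> P m" by (simp add: P_def)
    then show "P m \<noteq> {}" by blast
    show "countable (P m)"
      by (rule countable_subset[of _ "D \<times> D"]) (use D(1) in \<open>auto simp: P_def\<close>)
  qed
  have diff_le: "\<bar>F y \<upsilon> - F y' \<upsilon>\<bar> powr p \<le> (2 * \<bar>\<kappa> \<upsilon>\<bar>) powr p" if "y \<in> X" "y' \<in> X" for y y' \<upsilon>
  proof -
    have "\<bar>F y \<upsilon> - F y' \<upsilon>\<bar> \<le> 2 * \<bar>\<kappa> \<upsilon>\<bar>"
      using bound[OF that(1), of \<upsilon>] bound[OF that(2), of \<upsilon>] by linarith
    then show ?thesis using p_ge_1 by (auto intro: powr_mono2)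
  qed
  have bdd: "bdd_above ((\<lambda>(y, y'). \<bar>F y \<upsilon> - F y' \<upsilon>\<bar> powr p) ` P m)" for m \<upsilon>
    using diff_le D(2) by (intro bdd_aboveI[of _ "(2 * \<bar>\<kappa> \<upsilon>\<bar>) powr p"]) (auto simp: P_def)
  have G_meas: "G m \<in> borel_measurable borel" for m
    unfolding G_def[abs_def]
  proof (rule borel_measurable_cSUP[OF P(2)])
    fix q assume "q \<in> P m"
    then have "fst q \<in> X" "snd q \<in> X" using D(2) by (auto simp: P_def)
    from F_meas[OF this(1)] F_meas[OF this(2)]
    show "(\<lambda>\<upsilon>. case q of (y, y') \<Rightarrow> \<bar>F y \<upsilon> - F y' \<upsilon>\<bar> powr p) \<in> borel_measurable borel"
      unfolding case_prod_beta by measurable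
  qed (use bdd in auto)
  have G_upper: "\<bar>F y \<upsilon> - F y' \<upsilon>\<bar> powr p \<le> G m \<upsilon>" if "(y, y') \<in> P m" for y y' m \<upsilon>
    unfolding G_def using cSUP_upper[OF that bdd[of \<upsilon> m]] by simp
  have G_least: "G m \<upsilon> \<le> c" if "\<And>y y'. (y, y') \<in> P m \<Longrightarrow> \<bar>F y \<upsilon> - F y' \<upsilon>\<bar> powr p \<le> c" for m \<upsilon> c
    unfolding G_def using that by (intro cSUP_least[OF P(1)]) auto
  have G_nonneg: "0 \<le> G m \<upsilon>" for m \<upsilon>
  proof -
    obtain y y' where "(y, y') \<in> P m" using P(1) by (metis ex_in_conv surj_pair)
    from G_upper[OF this, of \<upsilon>] show ?thesis by (rule order_trans[rotated]) simp
  qed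
  have G_le: "\<bar>G m \<upsilon>\<bar> \<le> (2 * \<bar>\<kappa> \<upsilon>\<bar>) powr p" for m \<upsilon>
  proof -
    have "G m \<upsilon> \<le> (2 * \<bar>\<kappa> \<upsilon>\<bar>) powr p"
      by (rule G_least, rule diff_le) (use D(2) in \<open>auto simp: P_def\<close>)
    then show ?thesis using G_nonneg[of m \<upsilon>] by simp
  qed
  \<comment> \<open>For fixed \<open>\<upsilon>\<close>, compactness of \<open>X\<close> makes
    \<open>F\<close> uniformly continuous in its first argument.\<close>
  have G_lim: "(\<lambda>m. G m \<upsilon>) \<longlonglongrightarrow> 0" for \<upsilon>
  proof (rule tendstoI)
    fix e :: real assume e: "e > 0"
    \<comment> \<open>Bounds on all pairs give only a weak inequality for the supremum; halving
      \<open>e\<close> restores strictness.\<close>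
    define c where "c = (e / 2) powr (1 / p)"
    have c: "c > 0" "c powr p = e / 2"
      using e p_ge_1 by (auto simp: c_def powr_powr)
    obtain \<delta> where \<delta>: "\<delta> > 0" "\<And>y y'. y \<in> X \<Longrightarrow> y' \<in> X \<Longrightarrow> dist y' y < \<delta> \<Longrightarrow> dist (F y' \<upsilon>) (F y \<upsilon>) < c"
      using compact_uniformly_continuous[OF F_cont X, of \<upsilon>] c(1)
      unfolding uniformly_continuous_on_def by metis
    have "\<forall>\<^sub>F m in sequentially. 1 / real (Suc m) < \<delta>"
      using order_tendstoD(2)[OF LIMSEQ_inverse_real_of_nat \<delta>(1)] by (simp add: inverse_eq_divide)
    then show "\<forall>\<^sub>F m in sequentially. dist (G m \<upsilon>) 0 < e"
    proof eventually_elim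
      case (elim m)
      have "G m \<upsilon> \<le> e / 2"
      proof (rule G_least)
        fix y y' assume "(y, y') \<in> P m"
        then have "dist (F y \<upsilon>) (F y' \<upsilon>) < c"
          using elim D(2) by (intro \<delta>(2)) (auto simp: P_def)
        then show "\<bar>F y \<upsilon> - F y' \<upsilon>\<bar> powr p \<le> e / 2"
          unfolding c(2)[symmetric] dist_real_def using p_ge_1 by (intro powr_mono2) auto
      qed
      then show ?case using G_nonneg[of m \<upsilon>] e by (simp add: dist_real_def)
    qed
  qed
  have G_int: "(\<lambda>m. integral\<^sup>L M (G m \<circ> \<xi>)) \<longlonglongrightarrow> 0"
    by (rule integral_tendsto_0_of_powr_dominated[OF G_meas _ G_le G_lim]) simp
  \<comment> \<open>Extends the bound from \<open>D\<close> to \<open>X\<close>: points of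
    \<open>D\<close> converging to \<open>y\<close> eventually satisfy the strict distance
    condition, and continuity carries the estimate to \<open>y\<close>.\<close>
  have G_near: "\<bar>F y \<upsilon> - F d \<upsilon>\<bar> powr p \<le> G m \<upsilon>"
    if near: "y \<in> X" "d \<in> D" "dist y d < 1 / real (Suc m)" for y d m \<upsilon>
  proof -
    have "y \<in> closure D" using near(1) D(3) by blast
    then obtain w where w: "\<And>n. w n \<in> D" "w \<longlonglongrightarrow> y"
      unfolding closure_sequential by blast
    have "(\<lambda>n. F (w n) \<upsilon>) \<longlonglongrightarrow> F y \<upsilon>"
      by (rule continuous_on_tendsto_compose[OF F_cont w(2) near(1)]) (use w(1) D(2) in \<open>auto intro!: always_eventually\<close>)
    then have "(\<lambda>n. \<bar>F (w n) \<upsilon> - F d \<upsilon>\<bar>) \<longlonglongrightarrow> \<bar>F y \<upsilon> - F d \<upsilon>\<bar>"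
      by (intro tendsto_intros)
    then have "(\<lambda>n. \<bar>F (w n) \<upsilon> - F d \<upsilon>\<bar> powr p) \<longlonglongrightarrow> \<bar>F y \<upsilon> - F d \<upsilon>\<bar> powr p"
      by (intro tendsto_powr2) (use p_ge_1 in auto)
    moreover have "\<forall>\<^sub>F n in sequentially. dist (w n) d < 1 / real (Suc m)"
      using tendsto_dist[OF w(2) tendsto_const[of d]] near(3) by (rule order_tendstoD)
    then have "\<forall>\<^sub>F n in sequentially. \<bar>F (w n) \<upsilon> - F d \<upsilon>\<bar> powr p \<le> G m \<upsilon>"
      by eventually_elim (use w(1) near(2) in \<open>auto intro!: G_upper simp: P_def\<close>)
    ultimately show ?thesis
      by (rule tendsto_upperbound) simp
  qed
  \<comment> \<open>Naming the property allows one family to be chosen for each point of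
    \<open>D\<close>.\<close>
  define Q where "Q d H \<longleftrightarrow> countable H \<and>
    (\<forall>g\<in>H. g \<in> borel_measurable borel \<and> g \<circ> \<xi> \<in> Lp_space M (1 + \<epsilon> / p)) \<and>
    (\<forall>z N. (\<forall>g\<in>H. means_converge M \<xi> z g) \<longrightarrow> (\<forall>k. N k \<ge> 1) \<longrightarrow> filterlim N at_top sequentially \<longrightarrow>
      (\<lambda>k. risk (distr (empirical_measure z (N k)) borel (F d))) \<longlonglongrightarrow> \<rho> (F d \<circ> \<xi>))" for d H
  have "\<forall>d\<in>D. \<exists>H. Q d H"
    unfolding Q_def using D(2) F_meas bound by (intro ballI empirical_risk_test_functions) auto
  from bchoice[OF this] obtain H where "\<forall>d\<in>D. Q d (H d)" ..
  then have H: "countable (H d)"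
    "\<forall>g\<in>H d. g \<in> borel_measurable borel \<and> g \<circ> \<xi> \<in> Lp_space M (1 + \<epsilon> / p)"
    "\<forall>z N. (\<forall>g\<in>H d. means_converge M \<xi> z g) \<longrightarrow> (\<forall>k. N k \<ge> 1) \<longrightarrow> filterlim N at_top sequentially \<longrightarrow>
      (\<lambda>k. risk (distr (empirical_measure z (N k)) borel (F d))) \<longlonglongrightarrow> \<rho> (F d \<circ> \<xi>)"
    if "d \<in> D" for d
    using that unfolding Q_def by simp_all
  define H' where "H' = (\<Union>d\<in>D. H d) \<union> range G"
  have conv: "(\<lambda>k. risk (distr (empirical_measure z (N k)) borel (F (u k)))) \<longlonglongrightarrow> \<rho> (F a \<circ> \<xi>)"
    if mc: "\<forall>g\<in>H'. means_converge M \<xi> z g"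
      and N: "\<forall>k. N k \<ge> 1" "filterlim N at_top sequentially"
      and u: "\<forall>k. u k \<in> X" "u \<longlonglongrightarrow> a" for z N u a
  proof -
    have a: "a \<in> X"
      using compact_imp_closed[OF X] u closed_sequentially by blast
    show ?thesis
    proof (rule empirical_risk_tendsto_of_approx[OF \<xi> _ N(2) _ dominated_Lp[OF F_meas[OF a] bound[OF a]]])
      fix e :: real assume "e > 0"
      with order_tendstoD(2)[OF G_int] obtain m where m: "integral\<^sup>L M (G m \<circ> \<xi>) < e"
        by (meson eventually_happens' sequentially_bot)
      have "a \<in> closure D" "0 < 1 / real (Suc m)" using a D(3) by auto
      then obtain d where d: "d \<in> D" "dist d a < 1 / real (Suc m)"
        unfolding closure_approachable by blast
      \<comment> \<open>Being strict, this bound passes to \<open>dist (u k) d\<close> for large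
        \<open>k\<close>; thus the same \<open>G m\<close> controls both \<open>F a\<close> and
        \<open>F (u k)\<close> against \<open>F d\<close>.\<close>
      then have da: "dist a d < 1 / real (Suc m)" by (simp add: dist_commute)
      have "\<forall>\<^sub>F k in sequentially. dist (u k) d < 1 / real (Suc m)"
        using tendsto_dist[OF u(2) tendsto_const[of d]] da by (rule order_tendstoD)
      then have near: "\<forall>\<^sub>F k in sequentially. \<forall>\<upsilon>. \<bar>F (u k) \<upsilon> - F d \<upsilon>\<bar> powr p \<le> G m \<upsilon>"
        by eventually_elim (use G_near d(1) u(1) in auto)
      have dX: "d \<in> X" using d(1) D(2) by auto
      have "(\<lambda>k. risk (distr (empirical_measure z (N k)) borel (F d))) \<longlonglongrightarrow> \<rho> (F d \<circ> \<xi>)"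
        using mc d(1) by (intro H(3)[OF d(1), rule_format] N[rule_format]) (auto simp: H'_def)
      moreover have "integrable M (G m \<circ> \<xi>)"
        by (rule integrable_of_powr_dominated[OF G_meas _ G_le]) simp
      moreover have "means_converge M \<xi> z (G m)"
        using mc by (auto simp: H'_def)
      ultimately show "\<exists>g G. g \<in> borel_measurable borel \<and> g \<circ> \<xi> \<in> Lp_space M p \<and>
        (\<lambda>k. risk (distr (empirical_measure z (N k)) borel g)) \<longlonglongrightarrow> \<rho> (g \<circ> \<xi>) \<and>
        means_converge M \<xi> z G \<and> integrable M (G \<circ> \<xi>) \<and> integral\<^sup>L M (G \<circ> \<xi>) < e \<and>
        (\<forall>\<upsilon>. \<bar>F a \<upsilon> - g \<upsilon>\<bar> powr p \<le> G \<upsilon>) \<and>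
        (\<forall>\<^sub>F k in sequentially. \<forall>\<upsilon>. \<bar>F (u k) \<upsilon> - g \<upsilon>\<bar> powr p \<le> G \<upsilon>)"
        using m near F_meas[OF dX] dominated_Lp[OF F_meas[OF dX] bound[OF dX]] G_near[OF a d(1) da]
        by (intro exI[of _ "F d"] exI[of _ "G m"]) auto
    qed (use N(1) u(1) F_meas in auto)
  qed
  have ctble: "countable H'"
    unfolding H'_def using D(1) H(1) by auto
  have "G m \<circ> \<xi> \<in> Lp_space M (1 + \<epsilon> / p)" for m
    by (rule Lp_of_powr_dominated[OF G_meas _ G_le]) simp
  then have adm: "g \<in> borel_measurable borel \<and> g \<circ> \<xi> \<in> Lp_space M (1 + \<epsilon> / p)" if "g \<in> H'" for g
    using that H(2) G_meas unfolding H'_def by auto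
  show ?thesis
    by (intro exI[of _ H'] conjI ballI allI impI; (rule conv; assumption | simp add: adm ctble))
qed

end

end

section \<open>Closedness of the subdifferential inclusion\<close>

text \<open>The inclusion means that \<open>- v\<close> is a subgradient; spelled out as
  inequalities it can be compared with points of the epigraph.\<close>

lemma zero_in_plus_subdifferential_iff:
  "0 \<in> v +o subdifferential \<psi> a \<longleftrightarrow> (\<forall>y. \<psi> a + ereal (- (v \<bullet> (y - a))) \<le> \<psi> y)"
proof -
  have "0 \<in> v +o subdifferential \<psi> a \<longleftrightarrow> - v \<in> subdifferential \<psi> a"
    unfolding elt_set_plus_def by (force simp: eq_neg_iff_add_eq_0 add.commute dest: minus_unique)
  then show ?thesis
    by (simp add: subdifferential_def)
qed

text \<open>For finite \<open>\<psi> y = t\<close>, the subgradient inequality says that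
  \<open>(u k, t + v k \<bullet> (y - u k))\<close> lies in the epigraph. These points converge, and
  the closed epigraph contains their limit. An infinite value is trivial, and properness rules out
  minus infinity.\<close>

lemma subdifferential_inclusion_closed:
  fixes \<psi> :: "'v::euclidean_space \<Rightarrow> ereal"
  assumes \<psi>: "proper_fun \<psi>" "closed_fun \<psi>"
    and incl: "\<And>k. 0 \<in> v k +o subdifferential \<psi> (u k)"
    and u: "u \<longlonglongrightarrow> a" and v: "v \<longlonglongrightarrow> w"
  shows "0 \<in> w +o subdifferential \<psi> a"
  unfolding zero_in_plus_subdifferential_iff
proof
  fix y
  show "\<psi> a + ereal (- (w \<bullet> (y - a))) \<le> \<psi> y"
  proof (cases "\<psi> y")
    case (real t)
    have "\<psi> (u k) \<le> ereal (t + v k \<bullet> (y - u k))" for k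
    proof -
      have "\<psi> (u k) + ereal (- (v k \<bullet> (y - u k))) \<le> ereal t"
        using incl[of k] real unfolding zero_in_plus_subdifferential_iff by metis
      then show ?thesis by (cases "\<psi> (u k)") auto
    qed
    then have "(u k, t + v k \<bullet> (y - u k)) \<in> ereal_epigraph \<psi>" for k
      by (simp add: ereal_epigraph_def)
    moreover have "(\<lambda>k. (u k, t + v k \<bullet> (y - u k))) \<longlonglongrightarrow> (a, t + w \<bullet> (y - a))"
      by (intro tendsto_intros u v)
    ultimately have "(a, t + w \<bullet> (y - a)) \<in> ereal_epigraph \<psi>"
      using \<psi>(2) unfolding closed_fun_def by (rule closed_sequentially[rotated])
    then have "\<psi> a \<le> ereal (t + w \<bullet> (y - a))"
      by (simp add: ereal_epigraph_def)
    then show ?thesis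
      using real by (cases "\<psi> a") auto
  next
    case MInf
    then show ?thesis using \<psi>(1) by (simp add: proper_fun_def)
  qed simp
qed

section \<open>Almost sure passage to accumulation points\<close>

theorem lemma2:
  fixes M :: "'a measure"
    and \<xi> :: "'a \<Rightarrow> 'x::metric_space"
    and p \<epsilon> :: real
    and \<psi> :: "real ^ 'r \<Rightarrow> ereal"
    and X :: "(real ^ 'r) set"
    and \<rho> :: "'r \<Rightarrow> ('a \<Rightarrow> real) \<Rightarrow> real"
    and F :: "'r \<Rightarrow> real ^ 'r \<Rightarrow> 'x \<Rightarrow> real"
    and T :: "'t measure"
    and \<xi>s :: "nat \<Rightarrow> 't \<Rightarrow> 'x"
    and x :: "nat \<Rightarrow> 't \<Rightarrow> real ^ 'r"
  assumes "prob_space M" and "complete_measure M" and "nonatomic M"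
    and "separable_space (euclidean :: 'x topology)"
    and "\<xi> \<in> measurable M borel"
    and "1 \<le> p" and "0 \<le> \<epsilon>"
    and "proper_fun \<psi>" and "closed_fun \<psi>" and "convex_fun \<psi>"
    and "X = effective_domain \<psi>" and "compact X"
    and "\<And>j. caratheodory_on X (F j)"
    and "\<And>j. continuous_into_Lp M p X (\<lambda>y \<omega>. F j y (\<xi> \<omega>))"
    and "\<And>j. \<exists>\<kappa>\<in>borel_measurable borel.
           \<kappa> \<circ> \<xi> \<in> Lp_space M (p + \<epsilon>) \<and> (\<forall>y\<in>X. \<forall>\<upsilon>. \<bar>F j y \<upsilon>\<bar> \<le> \<kappa> \<upsilon>)"
    and "\<And>j. convex_risk_measure M p (\<rho> j)"
    and "\<And>j. law_invariant M p (\<rho> j)"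
    and "\<And>j. Lipschitz_on_Lp M p (\<rho> j)"
    and "prob_space T"
    and "\<And>i. i \<ge> 1 \<Longrightarrow> \<xi>s i \<in> measurable T borel"
    and "\<And>g. g \<in> borel_measurable borel \<Longrightarrow> g \<circ> \<xi> \<in> Lp_space M (1 + \<epsilon> / p) \<Longrightarrow>
           AE \<theta> in T. (\<lambda>N. (1 / real N) * (\<Sum>i=1..N. g (\<xi>s i \<theta>))) \<longlonglongrightarrow> (\<integral>\<omega>. (g \<circ> \<xi>) \<omega> \<partial>M)"
    and "AE \<theta> in T. \<forall>N\<ge>1. x N \<theta> \<in> X \<and>
           0 \<in> (\<chi> j. risk_of_distribution M p (\<rho> j)
                     (distr (empirical_measure (\<lambda>i. \<xi>s i \<theta>) N) borel (F j (x N \<theta>))))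
               +o subdifferential \<psi> (x N \<theta>)"
  shows "AE \<theta> in T. \<forall>a. accumulation_point (\<lambda>N. x N \<theta>) a \<longrightarrow>
           0 \<in> (\<chi> j. \<rho> j (\<lambda>\<omega>. F j a (\<xi> \<omega>))) +o subdifferential \<psi> a"
proof -
  \<comment> \<open>One family per coordinate is to be fixed before any sample point, subsequence or
    limit is considered.\<close>
  define Q where "Q j H \<longleftrightarrow> countable H \<and>
    (\<forall>g\<in>H. g \<in> borel_measurable borel \<and> g \<circ> \<xi> \<in> Lp_space M (1 + \<epsilon> / p)) \<and>
    (\<forall>z N u a. (\<forall>g\<in>H. means_converge M \<xi> z g) \<longrightarrow> (\<forall>k. N k \<ge> 1) \<longrightarrow>
      filterlim N at_top sequentially \<longrightarrow> (\<forall>k. u k \<in> X) \<longrightarrow> u \<longlonglongrightarrow> a \<longrightarrow>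
      (\<lambda>k. risk_of_distribution M p (\<rho> j) (distr (empirical_measure z (N k)) borel (F j (u k))))
        \<longlonglongrightarrow> \<rho> j (F j a \<circ> \<xi>))" for j H
  have "\<exists>H. Q j H" for j
  proof -
    obtain L where L: "L \<ge> 0" "\<And>Y Z. Y \<in> Lp_space M p \<Longrightarrow> Z \<in> Lp_space M p \<Longrightarrow>
        \<bar>\<rho> j Y - \<rho> j Z\<bar> \<le> L * Lp_norm M p (\<lambda>\<omega>. Y \<omega> - Z \<omega>)"
      using assms(18)[of j] unfolding Lipschitz_on_Lp_def by blast
    interpret prob_space M by fact
    interpret Lp_risk M p L "\<rho> j"
      by unfold_locales (use assms(3,6) assms(17)[of j] L in auto)
    obtain \<kappa> where \<kappa>: "\<kappa> \<in> borel_measurable borel" "\<kappa> \<circ> \<xi> \<in> Lp_space M (p + \<epsilon>)"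
      "\<And>y \<upsilon>. y \<in> X \<Longrightarrow> \<bar>F j y \<upsilon>\<bar> \<le> \<kappa> \<upsilon>"
      using assms(15)[of j] by blast
    show ?thesis
      unfolding Q_def
      by (rule empirical_risk_test_functions_parametric[OF assms(5,7) \<kappa>(1,2) assms(12) assms(13) \<kappa>(3)])
  qed
  then have "\<forall>j. \<exists>H. Q j H" by blast
  from choice[OF this] obtain H where "\<forall>j. Q j (H j)" ..
  then have H: "countable (H j)"
    "\<forall>g\<in>H j. g \<in> borel_measurable borel \<and> g \<circ> \<xi> \<in> Lp_space M (1 + \<epsilon> / p)"
    "\<forall>z N u a. (\<forall>g\<in>H j. means_converge M \<xi> z g) \<longrightarrow> (\<forall>k. N k \<ge> 1) \<longrightarrow>
      filterlim N at_top sequentially \<longrightarrow> (\<forall>k. u k \<in> X) \<longrightarrow> u \<longlonglongrightarrow> a \<longrightarrow>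
      (\<lambda>k. risk_of_distribution M p (\<rho> j) (distr (empirical_measure z (N k)) borel (F j (u k))))
        \<longlonglongrightarrow> \<rho> j (F j a \<circ> \<xi>)" for j
    unfolding Q_def by simp_all
  have "AE \<theta> in T. means_converge M \<xi> (\<lambda>i. \<xi>s i \<theta>) g" if "g \<in> H j" for g j
    unfolding means_converge_def using that H(2)[of j] by (intro assms(21)) auto
  \<comment> \<open>Finitely many coordinates with countable families leave countably many null
    sets, so one almost sure event serves all accumulation points at once.\<close>
  then have "AE \<theta> in T. \<forall>j\<in>UNIV. \<forall>g\<in>H j. means_converge M \<xi> (\<lambda>i. \<xi>s i \<theta>) g"
    by (intro AE_finite_allI finite AE_ball_countable'[OF _ H(1)])
  with assms(22) show ?thesis
  proof eventually_elim
    case (elim \<theta>)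
    show ?case
    proof (intro allI impI)
      fix a assume "accumulation_point (\<lambda>N. x N \<theta>) a"
      then obtain s where s: "strict_mono s" "((\<lambda>N. x N \<theta>) \<circ> s) \<longlonglongrightarrow> a"
        unfolding accumulation_point_def by blast
      \<comment> \<open>The shift discards \<open>s 0\<close>, which may be \<open>0\<close>, where
        the empirical measure is meaningless; strict monotonicity makes all later indices at least
        \<open>1\<close>.\<close>
      define N where "N k = s (Suc k)" for k
      have N: "\<forall>k. N k \<ge> 1"
        unfolding N_def by (intro allI order_trans[OF _ seq_suble[OF s(1)]]) simp
      have N_lim: "filterlim N at_top sequentially"
        unfolding N_def using filterlim_subseq[OF s(1)] by (rule filterlim_compose) (rule filterlim_Suc)
      have u: "\<forall>k. x (N k) \<theta> \<in> X" "(\<lambda>k. x (N k) \<theta>) \<longlonglongrightarrow> a"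
        using elim(1) N LIMSEQ_Suc[OF s(2)] by (auto simp: N_def comp_def)
      let ?v = "\<lambda>k. \<chi> j. risk_of_distribution M p (\<rho> j)
        (distr (empirical_measure (\<lambda>i. \<xi>s i \<theta>) (N k)) borel (F j (x (N k) \<theta>)))"
      \<comment> \<open>Convergence in the finite-dimensional space is checked coordinate by
        coordinate along the same subsequence.\<close>
      have v: "?v \<longlonglongrightarrow> (\<chi> j. \<rho> j (F j a \<circ> \<xi>))"
        using elim(2) N N_lim u by (intro tendsto_vec_lambda H(3)[rule_format]) auto
      have incl: "0 \<in> ?v k +o subdifferential \<psi> (x (N k) \<theta>)" for k
        using elim(1) N by auto
      have "0 \<in> (\<chi> j. \<rho> j (F j a \<circ> \<xi>)) +o subdifferential \<psi> a"
        by (rule subdifferential_inclusion_closed[OF assms(8,9) incl u(2) v])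
      then show "0 \<in> (\<chi> j. \<rho> j (\<lambda>\<omega>. F j a (\<xi> \<omega>))) +o subdifferential \<psi> a"
        by (simp add: comp_def)
    qed
  qed
qed

end
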